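(* Let $\mathfrak g$ be a (finite-dimensional) reductive Lie algebra over an algebraically closed field of characteristic zero. If $e\in\mathfrak g$ and $(\operatorname{ad} e)^3=0$, then $D=(\operatorname{ad} e)^2$ is a quasi-derivation of $\mathfrak g$.
   Context: For $D\in\mathfrak{gl}(\mathfrak g)$, the derived operation of the Lie bracket is $[x,y]'_D=D([x,y])-[Dx,y]-[x,Dy]$, and the second derived operation is $[x,y]''_D=D([x,y]'_D)-[Dx,y]'_D-[x,Dy]'_D$. $D$ is a quasi-derivation of $\mathfrak g$ if $[\ ,\,]''_D$ is identically zero. *)

theory Defs
  imports "HOL-Computational_Algebra.Polynomial"
begin

(* The Lie algebra is the whole type 'g; subalgebras and ideals are subsets of it. *)
locale lie_algebra = vector_space scale
  for scale :: "'k::field \<Rightarrow> 'g::ab_group_add \<Rightarrow> 'g"  (infixr "*s" 75) +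
  fixes bracket :: "'g \<Rightarrow> 'g \<Rightarrow> 'g"
  assumes linear_bracket_left: "Vector_Spaces.linear scale scale (\<lambda>x. bracket x y)"
    and linear_bracket_right: "Vector_Spaces.linear scale scale (\<lambda>y. bracket x y)"
    and bracket_self: "bracket x x = 0"
    and jacobi: "bracket x (bracket y z) + bracket y (bracket z x) + bracket z (bracket x y) = 0"
begin

definition ad :: "'g \<Rightarrow> 'g \<Rightarrow> 'g" where
  "ad x = (\<lambda>y. bracket x y)"

definition center :: "'g set" where
  "center = {z. \<forall>x. bracket z x = 0}"

definition lie_ideal :: "'g set \<Rightarrow> bool" where
  "lie_ideal I \<longleftrightarrow> subspace I \<and> (\<forall>x. \<forall>y\<in>I. bracket x y \<in> I)"

fun derived_series :: "'g set \<Rightarrow> nat \<Rightarrow> 'g set" where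
  "derived_series H 0 = H"
| "derived_series H (Suc n) =
     span {bracket x y | x y. x \<in> derived_series H n \<and> y \<in> derived_series H n}"

definition solvable :: "'g set \<Rightarrow> bool" where
  "solvable H \<longleftrightarrow> (\<exists>n. derived_series H n = {0})"

(* R is the largest solvable ideal; it is unique, and it exists in finite dimension. *)
definition is_radical :: "'g set \<Rightarrow> bool" where
  "is_radical R \<longleftrightarrow> lie_ideal R \<and> solvable R \<and>
     (\<forall>I. lie_ideal I \<and> solvable I \<longrightarrow> I \<subseteq> R)"

(* Of the equivalent characterizations in characteristic zero: Rad(g) = Z(g). *)
definition reductive :: bool where
  "reductive \<longleftrightarrow> is_radical center"

end

(* Stated for an arbitrary operation op, so that it can be iterated. *)
definition derived_operation :: "('g \<Rightarrow> 'g) \<Rightarrow> ('g \<Rightarrow> 'g \<Rightarrow> 'g) \<Rightarrow> 'g \<Rightarrow> 'g \<Rightarrow> 'g::ab_group_add" where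
  "derived_operation D op x y = D (op x y) - op (D x) y - op x (D y)"

context lie_algebra
begin

definition quasi_derivation :: "('g \<Rightarrow> 'g) \<Rightarrow> bool" where
  "quasi_derivation D \<longleftrightarrow> Vector_Spaces.linear scale scale D \<and>
     (\<forall>x y. derived_operation D (derived_operation D bracket) x y = 0)"

end

end

theory Submission
  imports Defs
begin

text \<open>
  Write \<open>a = ad e\<close>, a derivation with \<open>a\<^sup>3 = 0\<close>. By the Leibniz rule the derived operation of
  the bracket along \<open>a\<^sup>2\<close> is \<open>2 [a x, a y]\<close>; deriving once more along \<open>a\<^sup>2\<close>, and dropping every term
  that contains \<open>a\<^sup>3\<close>, leaves \<open>4 [a\<^sup>2 x, a\<^sup>2 y]\<close>. Among the terms of the Leibniz expansion of
  \<open>a\<^sup>4 [x, y]\<close>, only the middle one \<open>6 [a\<^sup>2 x, a\<^sup>2 y]\<close> avoids \<open>a\<^sup>3\<close>. As \<open>a\<^sup>4 = 0\<close> and 6 is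
  invertible in the field, the brackets \<open>[a\<^sup>2 x, a\<^sup>2 y]\<close> vanish
  (lemma \<open>bracket_derivation_squares_eq_0\<close>), and with them the second derived operation
  (lemma \<open>second_derived_operation_derivation_square\<close>).
\<close>

context lie_algebra
begin

lemma bracket_add_left: "bracket (x + y) z = bracket x z + bracket y z"
  using linear_bracket_left[of z] by (rule Vector_Spaces.linear.axioms(3)[THEN module_hom.add])

lemma bracket_add_right: "bracket x (y + z) = bracket x y + bracket x z"
  using linear_bracket_right[of x] by (rule Vector_Spaces.linear.axioms(3)[THEN module_hom.add])

lemma bracket_zero_left [simp]: "bracket 0 x = 0"
  using bracket_add_left[of 0 0 x] by simp

lemma bracket_zero_right [simp]: "bracket x 0 = 0"
  using bracket_add_right[of x 0 0] by simp

lemma bracket_antisym: "bracket y x = - bracket x y"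
proof -
  have "bracket (x + y) (x + y) = 0"
    by (rule bracket_self)
  then have "bracket x x + bracket y x + (bracket x y + bracket y y) = 0"
    by (simp only: bracket_add_left bracket_add_right)
  then have "bracket x y + bracket y x = 0"
    by (simp add: bracket_self add.commute)
  then show ?thesis
    by (simp add: eq_neg_iff_add_eq_0 add.commute)
qed

lemma bracket_minus_right: "bracket x (- y) = - bracket x y"
  using bracket_add_right[of x y "- y"] by (simp add: eq_neg_iff_add_eq_0 add.commute)

lemma ad_add: "ad e (x + y) = ad e x + ad e y"
  by (simp add: ad_def bracket_add_right)

text \<open>The Leibniz rule for \<open>ad e\<close> is the Jacobi identity, rearranged by antisymmetry.\<close>

lemma ad_derivation: "ad e (bracket x y) = bracket (ad e x) y + bracket x (ad e y)"
proof -
  have "bracket x (bracket y e) = - bracket x (bracket e y)"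
    using bracket_antisym[of e y] by (simp add: bracket_minus_right)
  moreover have "bracket y (bracket e x) = - bracket (bracket e x) y"
    by (rule bracket_antisym)
  ultimately show ?thesis
    using jacobi[of e x y] by (simp add: ad_def algebra_simps)
qed

text \<open>
  Expand \<open>d\<^sup>4 [x, y] = 0\<close> as the sum of the \<open>(4 choose i) [d\<^sup>i x, d\<^sup>4\<^sup>-\<^sup>i y]\<close>: unless \<open>i = 2\<close>, one of
  the exponents is at least 3. The surviving coefficient is \<open>(4 choose 2) = 6\<close>.
\<close>

lemma bracket_derivation_squares_eq_0:
  assumes add: "\<And>x y. d (x + y) = d x + d y"
    and leibniz: "\<And>x y. d (bracket x y) = bracket (d x) y + bracket x (d y)"
    and cube: "\<And>x. d (d (d x)) = 0"
    and six: "(6 :: 'k) \<noteq> 0"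
  shows "bracket (d (d x)) (d (d y)) = 0"
proof -
  define z where "z = bracket (d (d x)) (d (d y))"
  have "d 0 = 0"
    using add[of 0 0] by simp
  then have "d (d (d (d (bracket x y)))) = 0"
    by (simp only: cube)
  moreover have "d (d (d (d (bracket x y)))) = z + z + z + z + z + z"
    by (simp add: leibniz add cube z_def)
  moreover have "6 *s z = z + z + z + z + z + z"
  proof -
    have "6 *s z = (1 + 1 + 1 + 1 + 1 + 1) *s z"
      by simp
    also have "\<dots> = z + z + z + z + z + z"
      by (simp only: scale_left_distrib scale_one)
    finally show ?thesis .
  qed
  ultimately show ?thesis
    using six by (simp add: z_def)
qed

text \<open>
  The second derived operation is \<open>2 d\<^sup>2 [d x, d y]\<close>, since its two correction terms contain
  \<open>d\<^sup>3\<close>. For the same reason only the cross term of \<open>d\<^sup>2 [d x, d y]\<close> remains, namely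
  \<open>2 [d\<^sup>2 x, d\<^sup>2 y]\<close>, which is zero by the previous lemma.
\<close>

lemma second_derived_operation_derivation_square:
  assumes add: "\<And>x y. d (x + y) = d x + d y"
    and leibniz: "\<And>x y. d (bracket x y) = bracket (d x) y + bracket x (d y)"
    and cube: "\<And>x. d (d (d x)) = 0"
    and six: "(6 :: 'k) \<noteq> 0"
  shows "derived_operation (d ^^ 2) (derived_operation (d ^^ 2) bracket) x y = 0"
proof -
  have zero: "d 0 = 0"
    using add[of 0 0] by simp
  have first: "derived_operation (d ^^ 2) bracket u v = bracket (d u) (d v) + bracket (d u) (d v)" for u v
    by (simp add: derived_operation_def numeral_2_eq_2 leibniz add)
  show ?thesis
    unfolding derived_operation_def[of _ "derived_operation (d ^^ 2) bracket"] first
    by (simp add: numeral_2_eq_2 leibniz add cube zero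
        bracket_derivation_squares_eq_0[OF add leibniz cube six])
qed

end

theorem theorem7p4:
  fixes scale :: "'k::{alg_closed_field, field_char_0} \<Rightarrow> 'g::ab_group_add \<Rightarrow> 'g"
    and bracket :: "'g \<Rightarrow> 'g \<Rightarrow> 'g"
    and e :: 'g
  assumes "lie_algebra scale bracket"
    and "\<exists>B. finite_dimensional_vector_space scale B"
    and "lie_algebra.reductive scale bracket"
    and "lie_algebra.ad bracket e ^^ 3 = (\<lambda>x. 0)"
  shows "lie_algebra.quasi_derivation scale bracket (lie_algebra.ad bracket e ^^ 2)"
proof -
  interpret lie_algebra scale bracket
    by fact
  have cube: "ad e (ad e (ad e x)) = 0" for x
    using fun_cong[OF assms(4), of x] by (simp add: numeral_3_eq_3)
  have "Vector_Spaces.linear scale scale (ad e)"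
    unfolding ad_def by (rule linear_bracket_right)
  then have "Vector_Spaces.linear scale scale (ad e ^^ 2)"
    by (simp add: numeral_2_eq_2 Vector_Spaces.linear_compose)
  moreover have "derived_operation (ad e ^^ 2) (derived_operation (ad e ^^ 2) bracket) x y = 0" for x y
    by (rule second_derived_operation_derivation_square[OF ad_add ad_derivation cube]) simp
  ultimately show ?thesis
    by (simp add: quasi_derivation_def)
qed

end
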